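(* There exists a five-dimensional non-diffuse Bieberbach group which does not contain any subgroup isomorphic to \[ \Delta_P=\langle x,y\mid x^{-1}y^{2}x=y^{-2},\ y^{-1}x^{2}y=x^{-2}\rangle . \]
   Context: A crystallographic group of dimension $n$ is a discrete and cocompact subgroup of the group $O(n)\ltimes\mathbb{R}^n$ of isometries of the Euclidean space $\mathbb{R}^n$. A Bieberbach group of dimension $n$ is a torsion-free crystallographic group of dimension $n$. A group $\Gamma$ is diffuse if every finite non-empty subset $A\subset\Gamma$ has an extremal point, i.e. an element $a\in A$ such that for every $g\in\Gamma\setminus\{1\}$ at least one of $ga$, $g^{-1}a$ is not in $A$. A group is non-diffuse if it is not diffuse. The group $\Delta_P$ is the three-dimensional Hantzsche-Wendt group. *)

theory Defs
  imports "HOL-Analysis.Analysis" "HOL-Algebra.Coset"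
begin

(* The semidirect product of O(n) and R^n: the pair (A, a) stands for the isometry v |-> A v + a,
   and multiplication is composition.  Its topology is the subspace topology inherited from the
   product type (real^'n^'n) * (real^'n). *)
definition euclidean_group :: "((real^'n^'n) \<times> (real^'n)) monoid" where
  "euclidean_group =
    \<lparr>carrier = {(A, a). orthogonal_matrix A},
     mult = (\<lambda>(A, a) (B, b). (A ** B, A *v b + a)),
     one = (mat 1, 0)\<rparr>"

lemma group_euclidean_group: "group (euclidean_group :: ((real^'n^'n) \<times> (real^'n)) monoid)"
proof (rule groupI)
  fix x :: "(real^'n^'n) \<times> (real^'n)"
  assume "x \<in> carrier euclidean_group"
  then obtain A a where x: "x = (A, a)" and A: "orthogonal_matrix A"
    by (auto simp: euclidean_group_def)
  have "(transpose A, - (transpose A *v a)) \<otimes>\<^bsub>euclidean_group\<^esub> x = \<one>\<^bsub>euclidean_group\<^esub>"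
    using A by (simp add: x euclidean_group_def orthogonal_matrix_def)
  moreover have "(transpose A, - (transpose A *v a)) \<in> carrier euclidean_group"
    using A by (simp add: euclidean_group_def)
  ultimately show "\<exists>y\<in>carrier euclidean_group. y \<otimes>\<^bsub>euclidean_group\<^esub> x = \<one>\<^bsub>euclidean_group\<^esub>"
    by blast
qed (auto simp: euclidean_group_def orthogonal_matrix_mul orthogonal_matrix_id matrix_mul_assoc
      matrix_vector_mul_assoc matrix_vector_right_distrib)

definition quotient_topology :: "'a topology \<Rightarrow> ('a \<Rightarrow> 'b) \<Rightarrow> 'b topology" where
  "quotient_topology X f =
    topology (\<lambda>U. U \<subseteq> f ` topspace X \<and> openin X {x \<in> topspace X. f x \<in> U})"

lemma openin_quotient_topology:
  "openin (quotient_topology X f) U \<longleftrightarrow>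
    U \<subseteq> f ` topspace X \<and> openin X {x \<in> topspace X. f x \<in> U}"
proof -
  let ?P = "\<lambda>U. U \<subseteq> f ` topspace X \<and> openin X {x \<in> topspace X. f x \<in> U}"
  have "?P (S \<inter> T)" if "?P S" "?P T" for S T
  proof -
    have "{x \<in> topspace X. f x \<in> S \<inter> T} =
        {x \<in> topspace X. f x \<in> S} \<inter> {x \<in> topspace X. f x \<in> T}"
      by blast
    then show ?thesis using that by auto
  qed
  moreover have "?P (\<Union>K)" if "\<And>S. S \<in> K \<Longrightarrow> ?P S" for K
  proof -
    have "{x \<in> topspace X. f x \<in> \<Union>K} = (\<Union>S\<in>K. {x \<in> topspace X. f x \<in> S})"
      by blast
    moreover have "openin X \<dots>" using that by blast
    moreover have "\<Union>K \<subseteq> f ` topspace X" using that by blast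
    ultimately show ?thesis by simp
  qed
  ultimately have "istopology ?P"
    unfolding istopology_def by (intro conjI allI impI) presburger+
  then show ?thesis
    unfolding quotient_topology_def by simp
qed

lemma topspace_quotient_topology: "topspace (quotient_topology X f) = f ` topspace X"
proof -
  have "{x \<in> topspace X. f x \<in> f ` topspace X} = topspace X"
    by blast
  then have "openin (quotient_topology X f) (f ` topspace X)"
    by (simp add: openin_quotient_topology)
  then show ?thesis
    by (meson openin_quotient_topology openin_subset openin_topspace subset_antisym)
qed

lemma quotient_map_quotient_topology: "quotient_map X (quotient_topology X f) f"
  by (auto simp: quotient_map_def openin_quotient_topology topspace_quotient_topology)

definition crystallographic :: "((real^'n^'n) \<times> (real^'n)) set \<Rightarrow> bool" where
  "crystallographic \<Gamma> \<longleftrightarrow>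
    subgroup \<Gamma> euclidean_group \<and>
    discrete \<Gamma> \<and>
    compact_space
      (quotient_topology (top_of_set (carrier euclidean_group)) (\<lambda>g. \<Gamma> #>\<^bsub>euclidean_group\<^esub> g))"

definition torsion_free :: "('a, 'b) monoid_scheme \<Rightarrow> bool" where
  "torsion_free G \<longleftrightarrow>
    (\<forall>g\<in>carrier G. \<forall>k::nat. k > 0 \<and> g [^]\<^bsub>G\<^esub> k = \<one>\<^bsub>G\<^esub> \<longrightarrow> g = \<one>\<^bsub>G\<^esub>)"

definition bieberbach :: "((real^'n^'n) \<times> (real^'n)) set \<Rightarrow> bool" where
  "bieberbach \<Gamma> \<longleftrightarrow> crystallographic \<Gamma> \<and> torsion_free (euclidean_group\<lparr>carrier := \<Gamma>\<rparr>)"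

definition extremal_point :: "('a, 'b) monoid_scheme \<Rightarrow> 'a set \<Rightarrow> 'a \<Rightarrow> bool" where
  "extremal_point G A a \<longleftrightarrow>
    a \<in> A \<and> (\<forall>g\<in>carrier G - {\<one>\<^bsub>G\<^esub>}. g \<otimes>\<^bsub>G\<^esub> a \<notin> A \<or> inv\<^bsub>G\<^esub> g \<otimes>\<^bsub>G\<^esub> a \<notin> A)"

definition diffuse :: "('a, 'b) monoid_scheme \<Rightarrow> bool" where
  "diffuse G \<longleftrightarrow>
    (\<forall>A. A \<subseteq> carrier G \<and> finite A \<and> A \<noteq> {} \<longrightarrow> (\<exists>a. extremal_point G A a))"

(* A word is a list of letters; (s, True) is the generator s and (s, False) is its inverse.
   A presentation is given by the set R of its relations u = v, as pairs (u, v) of words, and all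
   elements of the type 's as generators.  The presented group consists of the words modulo the
   congruence generated by R and by the free cancellations. *)
inductive word_eq ::
  "(('s \<times> bool) list \<times> ('s \<times> bool) list) set \<Rightarrow> ('s \<times> bool) list \<Rightarrow> ('s \<times> bool) list \<Rightarrow> bool"
  for R where
  refl: "word_eq R u u"
| sym: "word_eq R u v \<Longrightarrow> word_eq R v u"
| trans: "word_eq R u v \<Longrightarrow> word_eq R v w \<Longrightarrow> word_eq R u w"
| cancel: "word_eq R (u @ [(s, b), (s, \<not> b)] @ v) (u @ v)"
| relation: "(l, r) \<in> R \<Longrightarrow> word_eq R (u @ l @ v) (u @ r @ v)"

definition word_rel ::
  "(('s \<times> bool) list \<times> ('s \<times> bool) list) set \<Rightarrow> (('s \<times> bool) list \<times> ('s \<times> bool) list) set" where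
  "word_rel R = {(u, v). word_eq R u v}"

definition presented_group ::
  "(('s \<times> bool) list \<times> ('s \<times> bool) list) set \<Rightarrow> ('s \<times> bool) list set monoid" where
  "presented_group R =
    \<lparr>carrier = UNIV // word_rel R,
     mult = (\<lambda>U V. \<Union>u\<in>U. \<Union>v\<in>V. word_rel R `` {u @ v}),
     one = word_rel R `` {[]}\<rparr>"

lemma equiv_word_rel: "equiv UNIV (word_rel R)"
  by (rule equivI)
    (auto simp: word_rel_def refl_on_def sym_def trans_def intro: word_eq.intros)

lemma word_eq_context: "word_eq R u v \<Longrightarrow> word_eq R (p @ u @ q) (p @ v @ q)"
proof (induction rule: word_eq.induct)
  case (cancel u s b v)
  then show ?case
    using word_eq.cancel[of R "p @ u" s b "v @ q"] by simp
next
  case (relation l r u v)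
  then show ?case
    using word_eq.relation[of l r R "p @ u" "v @ q"] by simp
qed (blast intro: word_eq.intros)+

lemma word_eq_append:
  assumes "word_eq R u u'" "word_eq R v v'"
  shows "word_eq R (u @ v) (u' @ v')"
  using word_eq_context[OF assms(1), of "[]" v] word_eq_context[OF assms(2), of u' "[]"]
  by (auto intro: word_eq.trans)

lemma mult_presented_group:
  "word_rel R `` {u} \<otimes>\<^bsub>presented_group R\<^esub> word_rel R `` {v} = word_rel R `` {u @ v}"
proof -
  have "congruent2 (word_rel R) (word_rel R) (\<lambda>u v. word_rel R `` {u @ v})"
    by (rule congruent2I'; rule equiv_class_eq[OF equiv_word_rel])
      (auto simp: word_rel_def intro: word_eq_append)
  then show ?thesis
    by (simp add: presented_group_def UN_equiv_class2[OF equiv_word_rel equiv_word_rel])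
qed

lemma word_eq_inverse: "word_eq R (map (\<lambda>(s, b). (s, \<not> b)) (rev u) @ u) []"
proof (induction u)
  case Nil
  show ?case by (simp add: word_eq.refl)
next
  case (Cons a u)
  obtain s b where a: "a = (s, b)" by (cases a)
  have "word_eq R (map (\<lambda>(s, b). (s, \<not> b)) (rev (a # u)) @ a # u)
      (map (\<lambda>(s, b). (s, \<not> b)) (rev u) @ u)"
    using word_eq.cancel[of R "map (\<lambda>(s, b). (s, \<not> b)) (rev u)" s "\<not> b" u] by (simp add: a)
  then show ?case
    using Cons.IH by (rule word_eq.trans)
qed

lemma group_presented_group: "group (presented_group R)"
proof (rule groupI)
  have carrier: "U \<in> carrier (presented_group R) \<longleftrightarrow> (\<exists>u. U = word_rel R `` {u})" for U
    by (auto simp: presented_group_def quotient_def)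
  have one: "\<one>\<^bsub>presented_group R\<^esub> = word_rel R `` {[]}"
    by (simp add: presented_group_def)
  show "\<one>\<^bsub>presented_group R\<^esub> \<in> carrier (presented_group R)"
    unfolding carrier one by blast
  fix U assume "U \<in> carrier (presented_group R)"
  then obtain u where U: "U = word_rel R `` {u}" unfolding carrier by blast
  show "\<one>\<^bsub>presented_group R\<^esub> \<otimes>\<^bsub>presented_group R\<^esub> U = U"
    by (simp add: U one mult_presented_group)
  have "word_rel R `` {map (\<lambda>(s, b). (s, \<not> b)) (rev u)} \<otimes>\<^bsub>presented_group R\<^esub> U =
      \<one>\<^bsub>presented_group R\<^esub>"
    unfolding U one mult_presented_group
    by (rule equiv_class_eq[OF equiv_word_rel]) (simp add: word_rel_def word_eq_inverse)
  then show "\<exists>V\<in>carrier (presented_group R). V \<otimes>\<^bsub>presented_group R\<^esub> U = \<one>\<^bsub>presented_group R\<^esub>"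
    using carrier by blast
  fix V assume "V \<in> carrier (presented_group R)"
  then obtain v where V: "V = word_rel R `` {v}" unfolding carrier by blast
  show "U \<otimes>\<^bsub>presented_group R\<^esub> V \<in> carrier (presented_group R)"
    unfolding carrier U V mult_presented_group by blast
  fix W assume "W \<in> carrier (presented_group R)"
  then obtain w where W: "W = word_rel R `` {w}" unfolding carrier by blast
  show "U \<otimes>\<^bsub>presented_group R\<^esub> V \<otimes>\<^bsub>presented_group R\<^esub> W =
      U \<otimes>\<^bsub>presented_group R\<^esub> (V \<otimes>\<^bsub>presented_group R\<^esub> W)"
    by (simp add: U V W mult_presented_group)
qed

datatype gen = Gen_x | Gen_y

(* x^-1 y^2 x = y^-2  and  y^-1 x^2 y = x^-2 *)
definition Delta_P :: "(gen \<times> bool) list set monoid" where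
  "Delta_P = presented_group
    {([(Gen_x, False), (Gen_y, True), (Gen_y, True), (Gen_x, True)], [(Gen_y, False), (Gen_y, False)]),
     ([(Gen_y, False), (Gen_x, True), (Gen_x, True), (Gen_y, True)], [(Gen_x, False), (Gen_x, False)])}"

end

theory Submission
  imports Defs
begin

text \<open>
  A crystallographic group whose holonomy fixes no nonzero vector is not diffuse: no \<open>(B, v)\<close> is
  extremal in the set of all elements with translation part of norm at most a large \<open>r\<close>, because if
  \<open>P\<close> in the holonomy moves \<open>v\<close> and \<open>t\<close> is close to \<open>(v - P v) / 2\<close>, then both \<open>P v + t\<close> and
  \<open>P\<^sup>-\<^sup>1 (v - t)\<close> have norm about \<open>\<parallel>v + P v\<parallel> / 2\<close>, which is less than \<open>\<parallel>v\<parallel>\<close> by a fixed factor.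

  The example has holonomy the dihedral group of order 8 and acts on the sum of a plane and three
  lines. On the plane it acts as the wallpaper group p4g, in which no centre of a quarter turn lies
  on a mirror; on the lines its holonomy acts by the three nontrivial characters. Every element
  with nontrivial holonomy translates some line that it does not reflect. If \<open>x\<close> and \<open>y\<close> satisfy the
  relations of \<open>\<Delta>\<^sub>P\<close>, then on each line they cannot both act as translations unless both act trivially.
  Apart from \<open>x = y = 1\<close>, this leaves only pairs of distinct types among quarter turns, glides along
  the axes, and diagonal (glide) reflections of the plane; these are excluded by the squares of the
  glides and by the position of the rotation centres relative to the mirrors.
\<close>

section \<open>Subgroups of the Euclidean group\<close>

lemma mult_euclidean_group [simp]:
  "(A, a) \<otimes>\<^bsub>euclidean_group\<^esub> (B, b) = (A ** B, A *v b + a)"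
  by (simp add: euclidean_group_def)

lemma one_euclidean_group: "\<one>\<^bsub>euclidean_group\<^esub> = (mat 1, 0)"
  by (simp add: euclidean_group_def)

lemma carrier_euclidean_group: "(A, a) \<in> carrier euclidean_group \<longleftrightarrow> orthogonal_matrix A"
  by (simp add: euclidean_group_def)

lemma inv_euclidean_group:
  assumes "orthogonal_matrix A"
  shows "inv\<^bsub>euclidean_group\<^esub> (A, a) = (transpose A, - (transpose A *v a))"
  using assms
  by (intro group.inv_equality[OF group_euclidean_group])
    (auto simp: carrier_euclidean_group one_euclidean_group orthogonal_matrix_def)

lemma norm_orthogonal_matrix:
  fixes A :: "real^'n^'n"
  assumes "orthogonal_matrix A"
  shows "norm (A *v v) = norm v"
proof -
  have "orthogonal_transformation ((*v) A)"
    using assms by (simp add: orthogonal_transformation_matrix)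
  then show ?thesis
    by (simp add: orthogonal_transformation)
qed

text \<open>Rows of an orthogonal matrix are unit vectors, which gives boundedness; orthonormality
  of the rows is a family of polynomial equations, which gives closedness.\<close>

lemma compact_orthogonal_matrices: "compact {A :: real^'n^'n. orthogonal_matrix A}"
proof -
  have "bounded {A :: real^'n^'n. orthogonal_matrix A}"
  proof -
    have "norm A \<le> of_nat CARD('n) * 1" if A: "orthogonal_matrix A" for A :: "real^'n^'n"
    proof -
      have "norm (A $ i) \<le> 1" for i
      proof -
        have "norm (transpose A *v axis i 1) = 1"
          using A by (subst norm_orthogonal_matrix) auto
        moreover have "transpose A *v axis i 1 = A $ i"
          by (simp add: matrix_vector_mul_component vec_eq_iff inner_axis transpose_def
              matrix_vector_mult_basis column_def)
        ultimately show ?thesis by simp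
      qed
      then have "(\<Sum>i\<in>UNIV. norm (A $ i)) \<le> of_nat CARD('n) * 1"
        by (intro sum_bounded_above) auto
      moreover have "norm A \<le> (\<Sum>i\<in>UNIV. norm (A $ i))"
        unfolding norm_vec_def by (intro L2_set_le_sum) auto
      ultimately show ?thesis by linarith
    qed
    then show ?thesis
      by (auto simp: bounded_iff)
  qed
  moreover have "closed {A :: real^'n^'n. orthogonal_matrix A}"
  proof -
    have "{A :: real^'n^'n. orthogonal_matrix A} = {A. \<forall>i j. A $ i \<bullet> A $ j = mat 1 $ i $ j}"
    proof -
      have "A ** transpose A = mat 1 \<longleftrightarrow> (\<forall>i j. A $ i \<bullet> A $ j = mat 1 $ i $ j)" for A :: "real^'n^'n"
        by (simp add: vec_eq_iff matrix_matrix_mult_def transpose_def inner_vec_def)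
      moreover have "orthogonal_matrix A \<longleftrightarrow> A ** transpose A = mat 1" for A :: "real^'n^'n"
        by (metis orthogonal_matrix_def matrix_left_right_inverse)
      ultimately show ?thesis by simp
    qed
    also have "closed \<dots>"
      by (intro closed_Collect_all closed_Collect_eq continuous_intros)
    finally show ?thesis .
  qed
  ultimately show ?thesis
    by (simp add: compact_eq_bounded_closed)
qed

text \<open>The coset of \<open>(A, a)\<close> contains \<open>(A, l + a)\<close> for every lattice
  vector \<open>l\<close>, so the quotient is the image of the compact set
  \<open>?K\<close>.\<close>

lemma crystallographicI:
  fixes \<Gamma> :: "((real^'n^'n) \<times> (real^'n)) set"
  assumes \<Gamma>: "subgroup \<Gamma> euclidean_group" and "discrete \<Gamma>"
    and lattice: "\<And>a. \<exists>l. (mat 1, l) \<in> \<Gamma> \<and> norm (l + a) \<le> D"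
  shows "crystallographic \<Gamma>"
proof -
  let ?G = "euclidean_group :: ((real^'n^'n) \<times> (real^'n)) monoid"
  let ?f = "\<lambda>g. \<Gamma> #>\<^bsub>?G\<^esub> g"
  let ?X = "top_of_set (carrier ?G)"
  let ?K = "{A. orthogonal_matrix A} \<times> cball 0 D :: ((real^'n^'n) \<times> (real^'n)) set"
  have K: "?K \<subseteq> carrier ?G"
    by (auto simp: carrier_euclidean_group)
  have "compact ?K"
    by (intro compact_Times compact_orthogonal_matrices compact_cball)
  then have "compactin ?X ?K"
    using K by (simp add: compactin_subtopology)
  then have "compactin (quotient_topology ?X ?f) (?f ` ?K)"
    by (rule image_compactin) (intro quotient_imp_continuous_map quotient_map_quotient_topology)
  moreover have "?f ` ?K = topspace (quotient_topology ?X ?f)"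
  proof -
    have "?f g \<in> ?f ` ?K" if "g \<in> carrier ?G" for g
    proof -
      obtain A a where g: "g = (A, a)" and A: "orthogonal_matrix A"
        using \<open>g \<in> carrier ?G\<close> by (cases g) (auto simp: carrier_euclidean_group)
      obtain l where l: "(mat 1, l) \<in> \<Gamma>" "norm (l + a) \<le> D"
        using lattice by blast
      have "(A, l + a) \<in> ?f g"
        using l(1) unfolding g r_coset_def by (auto intro!: bexI[OF _ l(1)] simp: add.commute)
      then have "?f g = ?f (A, l + a)"
        using group.repr_independence[OF group_euclidean_group _ that \<Gamma>] by blast
      then show ?thesis
        using A l(2) by auto
    qed
    then show ?thesis
      using K by (auto simp: topspace_quotient_topology)
  qed
  ultimately show ?thesis
    using assms by (simp add: crystallographic_def compact_space_def)
qed

lemma not_diffuse_if_no_fixed_direction: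
  fixes \<Gamma> :: "((real^'n^'n) \<times> (real^'n)) set"
  assumes \<Gamma>: "subgroup \<Gamma> euclidean_group"
    and finite: "\<And>r. finite {g \<in> \<Gamma>. norm (snd g) \<le> r}"
    and lattice: "\<And>a. \<exists>l. (mat 1, l) \<in> \<Gamma> \<and> norm (l + a) \<le> D"
    and w: "(mat 1, w) \<in> \<Gamma>" "w \<noteq> 0"
    and move: "\<And>v. \<exists>g\<in>\<Gamma>. c * norm v \<le> norm (v - fst g *v v)" and c: "0 < c" "c \<le> 1"
  shows "\<not> diffuse (euclidean_group\<lparr>carrier := \<Gamma>\<rparr>)"
proof
  let ?G = "euclidean_group\<lparr>carrier := \<Gamma>\<rparr>"
  have orth: "orthogonal_matrix (fst g)" if "g \<in> \<Gamma>" for g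
    using subgroup.subset[OF \<Gamma>] that by (cases g) (auto simp: carrier_euclidean_group)
  have inv: "inv\<^bsub>?G\<^esub> g = (transpose (fst g), - (transpose (fst g) *v snd g))" if "g \<in> \<Gamma>" for g
    using group.m_inv_consistent[OF group_euclidean_group \<Gamma> that] inv_euclidean_group[OF orth[OF that]]
    by (metis prod.collapse)
  \<comment> \<open>By the parallelogram law, half of \<open>v + P *v v\<close> has norm at most
    \<open>q * norm v\<close> whenever \<open>P\<close> moves \<open>v\<close> by at least
    \<open>c * norm v\<close>.\<close>
  define q where "q = sqrt (1 - c\<^sup>2 / 4)"
  have c2: "0 < c\<^sup>2" "c\<^sup>2 \<le> 1"
    using c by (auto simp: power_le_one)
  then have q: "0 \<le> q" "q < 1" "q\<^sup>2 = 1 - c\<^sup>2 / 4"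
    by (auto simp: q_def real_sqrt_lt_1_iff)
  \<comment> \<open>The radius leaves room for the error \<open>D\<close> of approximation by
    lattice vectors; the bound \<open>norm w\<close> serves the case \<open>v = 0\<close>.\<close>
  define r where "r = max (norm w) (D / (1 - q))"
  have r: "norm w \<le> r" "q * r + D \<le> r"
  proof -
    have "D / (1 - q) \<le> r" by (simp add: r_def)
    then show "q * r + D \<le> r"
      using q by (simp add: field_simps)
  qed (simp add: r_def)
  have D: "0 \<le> D"
    using lattice[of 0] norm_ge_zero order.trans by blast
  define A where "A = {g \<in> \<Gamma>. norm (snd g) \<le> r}"
  assume "diffuse ?G"
  moreover have "A \<subseteq> carrier ?G" "finite A"
    using finite by (auto simp: A_def)
  moreover have "\<one>\<^bsub>euclidean_group\<^esub> \<in> A"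
    using subgroup.one_closed[OF \<Gamma>] r(1) norm_ge_zero[of w]
    by (simp add: A_def one_euclidean_group del: norm_ge_zero)
  then have "A \<noteq> {}" by blast
  ultimately obtain a where a: "extremal_point ?G A a"
    unfolding diffuse_def by meson
  obtain B v where Bv: "a = (B, v)" by (cases a)
  have a\<Gamma>: "a \<in> \<Gamma>" and v: "norm v \<le> r"
    using a by (auto simp: extremal_point_def A_def Bv)
  have "\<exists>g\<in>\<Gamma>. g \<noteq> \<one>\<^bsub>euclidean_group\<^esub> \<and> norm (fst g *v v + snd g) \<le> r \<and> norm (v - snd g) \<le> r"
  proof (cases "v = 0")
    case True
    then show ?thesis
      using w r(1) by (intro bexI[OF _ w(1)]) (simp add: one_euclidean_group)
  next
    case False
    obtain P s where P: "(P, s) \<in> \<Gamma>" "c * norm v \<le> norm (v - P *v v)"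
      using move[of v] by fastforce
    \<comment> \<open>The lattice vector corrects \<open>s\<close> to lie within \<open>D\<close> of
      half of \<open>v - P *v v\<close>.\<close>
    obtain l where l: "(mat 1, l) \<in> \<Gamma>" "norm (l + (s - (v - P *v v) /\<^sub>R 2)) \<le> D"
      using lattice by blast
    define t where "t = l + s"
    define e where "e = t - (v - P *v v) /\<^sub>R 2"
    have e: "norm e \<le> D"
      using l(2) by (simp add: e_def t_def algebra_simps)
    have "(P, t) \<in> \<Gamma>"
      using subgroup.m_closed[OF \<Gamma> l(1) P(1)] by (simp add: t_def add.commute)
    moreover have "P \<noteq> mat 1"
      using P(2) False c(1) by (auto simp: mult_le_0_iff)
    moreover have "norm ((v + P *v v) /\<^sub>R 2) \<le> q * r"
    proof -
      have Pv: "norm (P *v v) = norm v"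
        using norm_orthogonal_matrix orth[OF P(1)] by simp
      have "(norm (v + P *v v))\<^sup>2 + (norm (v - P *v v))\<^sup>2 = 2 * (norm v)\<^sup>2 + 2 * (norm (P *v v))\<^sup>2"
        by (simp add: power2_norm_eq_inner inner_add inner_diff algebra_simps)
      moreover have "(c * norm v)\<^sup>2 \<le> (norm (v - P *v v))\<^sup>2"
        using P(2) c(1) by (intro power_mono) auto
      ultimately have "(norm (v + P *v v))\<^sup>2 \<le> (4 - c\<^sup>2) * (norm v)\<^sup>2"
        by (simp add: Pv power_mult_distrib algebra_simps)
      also have "\<dots> = (2 * (q * norm v))\<^sup>2"
        by (simp add: power_mult_distrib q(3) algebra_simps)
      finally have "norm (v + P *v v) \<le> 2 * (q * norm v)"
        by (rule power2_le_imp_le) (use q(1) in simp)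
      also have "\<dots> \<le> 2 * (q * r)"
        using v q(1) by (simp add: mult_left_mono)
      finally show ?thesis by simp
    qed
    then have sum: "norm ((v + P *v v) /\<^sub>R 2) + norm e \<le> r"
      using e r(2) by linarith
    have "P *v v + t = (v + P *v v) /\<^sub>R 2 + e" "v - t = (v + P *v v) /\<^sub>R 2 - e"
      by (simp_all add: e_def vec_eq_iff add_divide_distrib diff_divide_distrib)
    then have "norm (P *v v + t) \<le> r" "norm (v - t) \<le> r"
      using norm_triangle_le[OF sum] norm_triangle_le_diff[OF sum] by (simp_all only:)
    ultimately show ?thesis
      by (intro bexI[of _ "(P, t)"]) (simp_all add: one_euclidean_group)
  qed
  then obtain g where g: "g \<in> \<Gamma>" "g \<noteq> \<one>\<^bsub>euclidean_group\<^esub>"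
    "norm (fst g *v v + snd g) \<le> r" "norm (v - snd g) \<le> r"
    by blast
  have "g \<otimes>\<^bsub>euclidean_group\<^esub> a \<in> A"
    using subgroup.m_closed[OF \<Gamma> g(1) a\<Gamma>] g(3) by (cases g) (simp add: A_def Bv)
  moreover have "inv\<^bsub>?G\<^esub> g \<otimes>\<^bsub>euclidean_group\<^esub> a \<in> A"
  proof -
    have "inv\<^bsub>?G\<^esub> g \<in> \<Gamma>"
      using group.m_inv_consistent[OF group_euclidean_group \<Gamma> g(1)] subgroup.m_inv_closed[OF \<Gamma> g(1)]
      by simp
    then have "inv\<^bsub>?G\<^esub> g \<otimes>\<^bsub>euclidean_group\<^esub> a \<in> \<Gamma>"
      by (rule subgroup.m_closed[OF \<Gamma> _ a\<Gamma>])
    moreover have "snd (inv\<^bsub>?G\<^esub> g \<otimes>\<^bsub>euclidean_group\<^esub> a) = transpose (fst g) *v (v - snd g)"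
      by (simp add: inv[OF g(1)] Bv matrix_vector_mult_diff_distrib)
    moreover have "norm (transpose (fst g) *v (v - snd g)) = norm (v - snd g)"
      by (rule norm_orthogonal_matrix) (use orth[OF g(1)] in simp)
    ultimately show ?thesis
      using g(4) by (simp add: A_def)
  qed
  ultimately show False
    using a g(1,2) by (auto simp: extremal_point_def)
qed

text \<open>On a coordinate that \<open>A\<close> leaves unchanged, translation parts of powers add
  up: the \<open>m\<close>-th power shifts it by \<open>m\<close> times
  \<open>a $ j\<close>.\<close>

lemma torsion_freeI:
  fixes \<Gamma> :: "((real^'n^'n) \<times> (real^'n)) set"
  assumes \<Gamma>: "subgroup \<Gamma> euclidean_group"
    and shift: "\<And>A a. (A, a) \<in> \<Gamma> \<Longrightarrow> (A, a) \<noteq> (mat 1, 0) \<Longrightarrow>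
      \<exists>j. (\<forall>v. (A *v v) $ j = v $ j) \<and> a $ j \<noteq> 0"
  shows "torsion_free (euclidean_group\<lparr>carrier := \<Gamma>\<rparr>)"
proof -
  let ?G = "euclidean_group\<lparr>carrier := \<Gamma>\<rparr>"
  interpret G: group ?G
    using subgroup.subgroup_is_group[OF \<Gamma> group_euclidean_group] .
  have "g = \<one>\<^bsub>?G\<^esub>" if g: "g \<in> \<Gamma>" and k: "k > 0" "g [^]\<^bsub>?G\<^esub> (k::nat) = \<one>\<^bsub>?G\<^esub>" for g k
  proof (rule ccontr)
    assume "g \<noteq> \<one>\<^bsub>?G\<^esub>"
    obtain A a where [simp]: "g = (A, a)" by (cases g)
    obtain j where j: "\<And>v. (A *v v) $ j = v $ j" "a $ j \<noteq> 0"
      using shift[of A a] g \<open>g \<noteq> \<one>\<^bsub>?G\<^esub>\<close> by (auto simp: one_euclidean_group)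
    have "(\<forall>v. (fst (g [^]\<^bsub>?G\<^esub> m) *v v) $ j = v $ j) \<and> snd (g [^]\<^bsub>?G\<^esub> m) $ j = of_nat m * a $ j"
      for m :: nat
    proof (induction m)
      case 0
      then show ?case by (simp add: one_euclidean_group)
    next
      case (Suc m)
      obtain B b where "g [^]\<^bsub>?G\<^esub> m = (B, b)" by fastforce
      then show ?case
        using Suc j(1) by (simp add: matrix_vector_mul_assoc[symmetric] algebra_simps)
    qed
    from this[of k] show False
      using k j(2) by (simp add: one_euclidean_group)
  qed
  then show ?thesis
    by (auto simp: torsion_free_def)
qed

section \<open>The group \<open>\<Delta>\<^sub>P\<close>\<close>

text \<open>The exponent sum of x is 0 on both sides of the first relation, and 2 and -2 on those of
  the second. Modulo 4 it detects that x is nontrivial.\<close>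

lemma Delta_P_abelian_invariant:
  assumes "word_eq
    {([(Gen_x, False), (Gen_y, True), (Gen_y, True), (Gen_x, True)], [(Gen_y, False), (Gen_y, False)]),
     ([(Gen_y, False), (Gen_x, True), (Gen_x, True), (Gen_y, True)], [(Gen_x, False), (Gen_x, False)])} u v"
  defines "e \<equiv> \<lambda>w. \<Sum>(s, b)\<leftarrow>w. if s = Gen_x then (if b then 1 else - 1) else (0 :: int)"
  shows "e u mod 4 = e v mod 4"
  using assms(1)
proof (induction rule: word_eq.induct)
  case (relation l r u v)
  then have "e l mod 4 = e r mod 4"
    by (auto simp: e_def)
  then have "(e u + e l + e v) mod 4 = (e u + e r + e v) mod 4"
    by (metis mod_add_cong)
  then show ?case
    by (simp add: e_def add.assoc)
qed (auto simp: e_def)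

text \<open>The relations are restated without inverses, so that multiplicativity alone transports
  them along a homomorphism.\<close>

lemma Delta_P_nontrivial_pair:
  obtains x y where "x \<in> carrier Delta_P" "y \<in> carrier Delta_P" "x \<noteq> \<one>\<^bsub>Delta_P\<^esub>"
    "y \<otimes>\<^bsub>Delta_P\<^esub> y \<otimes>\<^bsub>Delta_P\<^esub> x \<otimes>\<^bsub>Delta_P\<^esub> y \<otimes>\<^bsub>Delta_P\<^esub> y = x"
    "x \<otimes>\<^bsub>Delta_P\<^esub> x \<otimes>\<^bsub>Delta_P\<^esub> y \<otimes>\<^bsub>Delta_P\<^esub> x \<otimes>\<^bsub>Delta_P\<^esub> x = y"
proof -
  define R where "R =
    {([(Gen_x, False), (Gen_y, True), (Gen_y, True), (Gen_x, True)], [(Gen_y, False), (Gen_y, False)]),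
     ([(Gen_y, False), (Gen_x, True), (Gen_x, True), (Gen_y, True)], [(Gen_x, False), (Gen_x, False)])}"
  define cl where "cl w = word_rel R `` {w}" for w
  have Delta: "Delta_P = presented_group R"
    by (simp add: Delta_P_def R_def)
  have carrier: "cl w \<in> carrier Delta_P" for w
    by (simp add: Delta cl_def presented_group_def quotientI)
  have mult: "cl u \<otimes>\<^bsub>Delta_P\<^esub> cl v = cl (u @ v)" for u v
    by (simp add: Delta cl_def mult_presented_group)
  have eq: "cl u = cl v \<longleftrightarrow> word_eq R u v" for u v
    unfolding cl_def using eq_equiv_class_iff[OF equiv_word_rel] by (simp add: word_rel_def)
  \<comment> \<open>The computation is b b a b b = a (a^-1 b b a) b b = a b^-1 b^-1 b b = a.\<close>
  have conj: "word_eq R [(b, True), (b, True), (a, True), (b, True), (b, True)] [(a, True)]"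
    if "([(a, False), (b, True), (b, True), (a, True)], [(b, False), (b, False)]) \<in> R" for a b
  proof -
    note [trans] = word_eq.trans
    have "word_eq R [(b, True), (b, True), (a, True), (b, True), (b, True)]
        [(a, True), (a, False), (b, True), (b, True), (a, True), (b, True), (b, True)]"
      using word_eq.cancel[of R "[]" a True] by (auto intro: word_eq.sym)
    also have "word_eq R \<dots> [(a, True), (b, False), (b, False), (b, True), (b, True)]"
      using word_eq.relation[OF that, of "[(a, True)]" "[(b, True), (b, True)]"] by simp
    also have "word_eq R \<dots> [(a, True), (b, False), (b, True)]"
      using word_eq.cancel[of R "[(a, True), (b, False)]" b False "[(b, True)]"] by simp
    also have "word_eq R \<dots> [(a, True)]"
      using word_eq.cancel[of R "[(a, True)]" b False "[]"] by simp
    finally show ?thesis .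
  qed
  have "cl [(Gen_x, True)] \<noteq> \<one>\<^bsub>Delta_P\<^esub>"
  proof
    assume "cl [(Gen_x, True)] = \<one>\<^bsub>Delta_P\<^esub>"
    then have "word_eq R [(Gen_x, True)] []"
      using eq[of "[(Gen_x, True)]" "[]"] by (simp add: Delta cl_def presented_group_def)
    then show False
      unfolding R_def by (drule_tac Delta_P_abelian_invariant) simp
  qed
  then show thesis
    using that[of "cl [(Gen_x, True)]" "cl [(Gen_y, True)]"] conj[of Gen_x Gen_y] conj[of Gen_y Gen_x]
    by (simp add: carrier mult eq R_def)
qed

text \<open>An embedding of \<open>Delta_P\<close> would carry its nontrivial x to an element that
  \<open>rigid\<close> forces to be 1.\<close>

lemma no_Delta_P_subgroup:
  assumes "group G"
    and rigid: "\<And>x y. x \<in> carrier G \<Longrightarrow> y \<in> carrier G \<Longrightarrow>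
      y \<otimes>\<^bsub>G\<^esub> y \<otimes>\<^bsub>G\<^esub> x \<otimes>\<^bsub>G\<^esub> y \<otimes>\<^bsub>G\<^esub> y = x \<Longrightarrow>
      x \<otimes>\<^bsub>G\<^esub> x \<otimes>\<^bsub>G\<^esub> y \<otimes>\<^bsub>G\<^esub> x \<otimes>\<^bsub>G\<^esub> x = y \<Longrightarrow> x = \<one>\<^bsub>G\<^esub>"
  shows "\<not> (\<exists>H. subgroup H G \<and> G\<lparr>carrier := H\<rparr> \<cong> Delta_P)"
proof (rule notI, elim exE conjE)
  fix H assume H: "subgroup H G" and iso: "G\<lparr>carrier := H\<rparr> \<cong> Delta_P"
  let ?H = "G\<lparr>carrier := H\<rparr>"
  have gH: "group ?H"
    using subgroup.subgroup_is_group[OF H assms(1)] .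
  have gD: "group Delta_P"
    by (simp add: Delta_P_def group_presented_group)
  obtain f where f: "f \<in> iso Delta_P ?H"
    using group.iso_sym[OF gH iso] by (auto simp: is_iso_def)
  then have hom: "f \<in> hom Delta_P ?H" and inj: "inj_on f (carrier Delta_P)"
    by (auto simp: iso_def bij_betw_def)
  have mult: "f (u \<otimes>\<^bsub>Delta_P\<^esub> v) = f u \<otimes>\<^bsub>G\<^esub> f v"
    if "u \<in> carrier Delta_P" "v \<in> carrier Delta_P" for u v
    using hom_mult[OF hom that] by simp
  have closed: "f u \<in> carrier G" if "u \<in> carrier Delta_P" for u
    using hom_in_carrier[OF hom that] subgroup.subset[OF H] by auto
  have one: "f \<one>\<^bsub>Delta_P\<^esub> = \<one>\<^bsub>G\<^esub>"
    using hom_one[OF hom gD gH] by simp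
  obtain x y where xy: "x \<in> carrier Delta_P" "y \<in> carrier Delta_P" "x \<noteq> \<one>\<^bsub>Delta_P\<^esub>"
    "y \<otimes>\<^bsub>Delta_P\<^esub> y \<otimes>\<^bsub>Delta_P\<^esub> x \<otimes>\<^bsub>Delta_P\<^esub> y \<otimes>\<^bsub>Delta_P\<^esub> y = x"
    "x \<otimes>\<^bsub>Delta_P\<^esub> x \<otimes>\<^bsub>Delta_P\<^esub> y \<otimes>\<^bsub>Delta_P\<^esub> x \<otimes>\<^bsub>Delta_P\<^esub> x = y"
    by (rule Delta_P_nontrivial_pair)
  note D = group.is_monoid[OF gD]
  have "f x = \<one>\<^bsub>G\<^esub>"
  proof (rule rigid)
    show "f y \<otimes>\<^bsub>G\<^esub> f y \<otimes>\<^bsub>G\<^esub> f x \<otimes>\<^bsub>G\<^esub> f y \<otimes>\<^bsub>G\<^esub> f y = f x"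
      using arg_cong[OF xy(4), of f] xy(1,2) by (simp add: mult monoid.m_closed[OF D])
    show "f x \<otimes>\<^bsub>G\<^esub> f x \<otimes>\<^bsub>G\<^esub> f y \<otimes>\<^bsub>G\<^esub> f x \<otimes>\<^bsub>G\<^esub> f x = f y"
      using arg_cong[OF xy(5), of f] xy(1,2) by (simp add: mult monoid.m_closed[OF D])
  qed (use xy closed in auto)
  then show False
    using inj_onD[OF inj, of x "\<one>\<^bsub>Delta_P\<^esub>"] xy(1,3) one monoid.one_closed[OF D] by simp
qed

section \<open>A group with dihedral holonomy\<close>

lemma exhaust_5:
  fixes x :: 5
  shows "x = 1 \<or> x = 2 \<or> x = 3 \<or> x = 4 \<or> x = 5"
proof (induct x)
  case (of_int z)
  then have "z = 0 \<or> z = 1 \<or> z = 2 \<or> z = 3 \<or> z = 4" by fastforce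
  then show ?case by auto
qed

lemma forall_5: "(\<forall>i::5. P i) \<longleftrightarrow> P 1 \<and> P 2 \<and> P 3 \<and> P 4 \<and> P 5"
  by (metis exhaust_5)

lemma UNIV_5: "UNIV = {1, 2, 3, 4, 5::5}"
  using exhaust_5 by auto

lemma sum_5: "sum f (UNIV::5 set) = f 1 + f 2 + f 3 + f 4 + f 5"
  unfolding UNIV_5 by (simp add: ac_simps)

section \<open>Holonomy representation and admissible translations\<close>

definition neg_if :: "bool \<Rightarrow> 'a::ab_group_add \<Rightarrow> 'a" where
  "neg_if b x = (if b then - x else x)"

lemma neg_if_simps [simp]:
  "neg_if False x = x" "neg_if True x = - x"
  "neg_if b (neg_if b' x) = neg_if (b \<noteq> b') x"
  "neg_if b 0 = 0"
  "of_int (neg_if b k) = neg_if b (of_int k :: 'b::ring_1)"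
  by (simp_all add: neg_if_def)

text \<open>Coordinates 1 and 2 span the plane; 3, 4 and 5 are the lines. The sign flags \<open>c\<close> and \<open>d\<close> belong to
  the columns 1 and 2 of the signed permutation matrix, and \<open>p\<close> tells whether it swaps the two axes.\<close>

definition hol :: "bool \<Rightarrow> bool \<Rightarrow> bool \<Rightarrow> 'a::comm_ring_1^5 \<Rightarrow> 'a^5" where
  "hol p c d v = (\<chi> i.
    if i = 1 then (if p then neg_if d (v $ 2) else neg_if c (v $ 1))
    else if i = 2 then (if p then neg_if c (v $ 1) else neg_if d (v $ 2))
    else if i = 3 then neg_if (p \<noteq> (c \<noteq> d)) (v $ 3)
    else if i = 4 then neg_if p (v $ 4)
    else neg_if (c \<noteq> d) (v $ 5))"

lemma hol_nth [simp]:
  "hol p c d v $ 1 = (if p then neg_if d (v $ 2) else neg_if c (v $ 1))"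
  "hol p c d v $ 2 = (if p then neg_if c (v $ 1) else neg_if d (v $ 2))"
  "hol p c d v $ 3 = neg_if (p \<noteq> (c \<noteq> d)) (v $ 3)"
  "hol p c d v $ 4 = neg_if p (v $ 4)"
  "hol p c d v $ 5 = neg_if (c \<noteq> d) (v $ 5)"
  by (simp_all add: hol_def)

text \<open>If \<open>p'\<close> holds, the inner map sends axis 1 to axis 2, so column 1 picks up
  the outer sign \<open>d\<close> instead of \<open>c\<close>; likewise for column 2.\<close>

lemma hol_hol:
  "hol p c d (hol p' c' d' v) =
    hol (p \<noteq> p') (c' \<noteq> (if p' then d else c)) (d' \<noteq> (if p' then c else d)) v"
  by (cases p; cases p'; cases c; cases c'; cases d; cases d') (simp_all add: vec_eq_iff forall_5)

text \<open>The axes are rescaled so that all translation parts are integral: the translation lattice is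
  \<open>(2\<int>)\<^sup>2 \<times> 4\<int> \<times> (2\<int>)\<^sup>2\<close>. In terms of a quarter turn \<open>r\<close> and a reflection \<open>s\<close>, the number
  \<open>of_bool p + 2 * of_bool c\<close> is the exponent \<open>k\<close> of the holonomy element \<open>r\<^sup>k s\<^sup>j\<close>.\<close>

definition admissible :: "bool \<Rightarrow> bool \<Rightarrow> bool \<Rightarrow> int^5 \<Rightarrow> bool" where
  "admissible p c d n \<longleftrightarrow>
    (\<forall>i\<in>{1, 2, 4}. odd (n $ i) \<longleftrightarrow> p \<noteq> (c \<noteq> d)) \<and>
    4 dvd n $ 3 - (of_bool p + 2 * of_bool c) \<and>
    (odd (n $ 5) \<longleftrightarrow> p)"

text \<open>Coordinate 3 composes modulo 4 as k + (-1)^j k', exactly like the exponents of r^k s^j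
  in the dihedral group. The parities are homomorphisms to Z/2, blind to signs and to the swap of
  coordinates 1 and 2, which share their parity.\<close>

lemma admissible_mult:
  assumes "admissible p c d n" "admissible p' c' d' n'"
  shows "admissible (p \<noteq> p') (c' \<noteq> (if p' then d else c)) (d' \<noteq> (if p' then c else d)) (hol p c d n' + n)"
proof -
  have "4 dvd n $ 3 - (of_bool p + 2 * of_bool c)" "4 dvd n' $ 3 - (of_bool p' + 2 * of_bool c')"
    using assms by (simp_all add: admissible_def)
  then have "4 dvd neg_if (p \<noteq> (c \<noteq> d)) (n' $ 3) + n $ 3 -
      (of_bool (p \<noteq> p') + 2 * of_bool (c' \<noteq> (if p' then d else c)))"
    by (cases p; cases p'; cases c; cases c'; cases d; simp; presburger)
  with assms show ?thesis
    unfolding admissible_def by (cases p; cases p'; cases c; cases c'; cases d; cases d'; simp)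
qed

lemma admissible_inverse:
  assumes "admissible p c d n"
  shows "admissible p (if p then d else c) (if p then c else d)
    (- hol p (if p then d else c) (if p then c else d) n)"
proof -
  have "4 dvd n $ 3 - (of_bool p + 2 * of_bool c)"
    using assms by (simp add: admissible_def)
  then have "4 dvd - neg_if (p \<noteq> (c \<noteq> d)) (n $ 3) - (of_bool p + 2 * of_bool (if p then d else c))"
    by (cases p; cases c; cases d; simp; presburger)
  with assms show ?thesis
    unfolding admissible_def by (cases p; cases c; cases d; simp)
qed

section \<open>Realization by isometries of Euclidean space\<close>

definition motion :: "bool \<Rightarrow> bool \<Rightarrow> bool \<Rightarrow> int^5 \<Rightarrow> (real^5^5) \<times> (real^5)" where
  "motion p c d n = (matrix (hol p c d), \<chi> i. of_int (n $ i))"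

lemma linear_hol: "linear (hol p c d :: real^5 \<Rightarrow> real^5)"
  by (rule linearI) (auto simp: vec_eq_iff forall_5 neg_if_def)

lemma matrix_hol [simp]: "matrix (hol p c d) *v v = hol p c d (v :: real^5)"
  using fun_cong[OF matrix_vector_mul(2)[OF linear_hol], of p c d v] by simp

lemma orthogonal_matrix_hol: "orthogonal_matrix (matrix (hol p c d) :: real^5^5)"
proof -
  have "orthogonal_transformation (hol p c d :: real^5 \<Rightarrow> real^5)"
    unfolding orthogonal_transformation_def
    by (auto simp: linear_hol inner_vec_def sum_5 neg_if_def)
  then show ?thesis
    by (simp add: orthogonal_transformation_matrix)
qed

lemma matrix_hol_1: "matrix (hol False False False) = (mat 1 :: real^5^5)"
  unfolding matrix_eq by (simp add: vec_eq_iff forall_5)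

lemma motion_mult:
  "motion p c d n \<otimes>\<^bsub>euclidean_group\<^esub> motion p' c' d' n' =
    motion (p \<noteq> p') (c' \<noteq> (if p' then d else c)) (d' \<noteq> (if p' then c else d)) (hol p c d n' + n)"
proof -
  have "matrix (hol p c d) ** matrix (hol p' c' d') =
      (matrix (hol (p \<noteq> p') (c' \<noteq> (if p' then d else c)) (d' \<noteq> (if p' then c else d))) :: real^5^5)"
    unfolding matrix_eq by (simp add: matrix_vector_mul_assoc[symmetric] hol_hol del: hol_nth)
  moreover have "hol p c d (\<chi> i. of_int (n' $ i)) + (\<chi> i. of_int (n $ i)) =
      (\<chi> i. real_of_int ((hol p c d n' + n) $ i))"
    by (simp add: vec_eq_iff forall_5)
  ultimately show ?thesis
    by (simp only: motion_def mult_euclidean_group matrix_hol)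
qed

lemma motion_one: "motion False False False 0 = \<one>\<^bsub>euclidean_group\<^esub>"
  by (simp add: motion_def one_euclidean_group matrix_hol_1 vec_eq_iff)

definition dihedral_group :: "((real^5^5) \<times> (real^5)) set" where
  "dihedral_group = {motion p c d n | p c d n. admissible p c d n}"

lemma dihedral_groupE:
  assumes "g \<in> dihedral_group"
  obtains p c d n where "g = motion p c d n" "admissible p c d n"
  using assms by (auto simp: dihedral_group_def)

lemma motion_in_dihedral_group: "admissible p c d n \<Longrightarrow> motion p c d n \<in> dihedral_group"
  by (auto simp: dihedral_group_def)

lemma subgroup_dihedral_group: "subgroup dihedral_group euclidean_group"
proof (rule group.subgroupI[OF group_euclidean_group])
  show sub: "dihedral_group \<subseteq> carrier euclidean_group"
    by (auto elim!: dihedral_groupE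
        simp: motion_def carrier_euclidean_group orthogonal_matrix_hol)
  have "admissible False False False 0"
    by (simp add: admissible_def)
  then show "dihedral_group \<noteq> {}"
    using motion_in_dihedral_group by blast
  show "g \<otimes>\<^bsub>euclidean_group\<^esub> h \<in> dihedral_group" if "g \<in> dihedral_group" "h \<in> dihedral_group" for g h
    using that
    by (elim dihedral_groupE) (simp only: motion_mult motion_in_dihedral_group admissible_mult)
  show "inv\<^bsub>euclidean_group\<^esub> g \<in> dihedral_group" if g: "g \<in> dihedral_group" for g
  proof -
    obtain p c d n where g_eq: "g = motion p c d n" and n: "admissible p c d n"
      using g by (rule dihedral_groupE)
    let ?h = "motion p (if p then d else c) (if p then c else d)
        (- hol p (if p then d else c) (if p then c else d) n)"
    have h: "?h \<in> dihedral_group"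
      using n by (intro motion_in_dihedral_group admissible_inverse)
    have "?h \<otimes>\<^bsub>euclidean_group\<^esub> g = \<one>\<^bsub>euclidean_group\<^esub>"
      unfolding g_eq motion_mult motion_one[symmetric] by (cases p; cases c; cases d; simp)
    then have "inv\<^bsub>euclidean_group\<^esub> g = ?h"
      by (rule group.inv_equality[OF group_euclidean_group _ subsetD[OF sub g] subsetD[OF sub h]])
    then show ?thesis
      using h by (simp only:)
  qed
qed

section \<open>Discreteness, lattice, displacements and translated lines\<close>

lemma uniform_discrete_dihedral_group: "uniform_discrete dihedral_group"
  unfolding uniform_discrete_def
proof (intro exI[of _ 1] conjI ballI impI)
  fix g h assume gh: "g \<in> dihedral_group" "h \<in> dihedral_group" and dist: "dist g h < 1"
  \<comment> \<open>All entries are integers, so elements at distance less than 1 agree in each of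
    them.\<close>
  have int: "fst g $ i $ j \<in> \<int>" "snd g $ i \<in> \<int>" if g: "g \<in> dihedral_group" for g i j
  proof -
    obtain p c d n where g_eq: "g = motion p c d n"
      using g by (rule dihedral_groupE)
    show "fst g $ i $ j \<in> \<int>" "snd g $ i \<in> \<int>"
      by (auto simp: g_eq motion_def matrix_def hol_def axis_def neg_if_def)
  qed
  have eq: "x = y" if "x \<in> \<int>" "y \<in> \<int>" "\<bar>x - y\<bar> < 1" for x y :: real
    using that by (auto elim!: Ints_cases)
  have "\<bar>fst g $ i $ j - fst h $ i $ j\<bar> < 1" for i j
    using dist dist_fst_le[of g h] dist_vec_nth_le[of "fst g" i "fst h"]
      dist_vec_nth_le[of "fst g $ i" j "fst h $ i"] by (simp add: dist_real_def)
  then have "fst g = fst h"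
    using eq int gh by (simp add: vec_eq_iff)
  moreover have "\<bar>snd g $ i - snd h $ i\<bar> < 1" for i
    using dist dist_snd_le[of g h] dist_vec_nth_le[of "snd g" i "snd h"] by (simp add: dist_real_def)
  then have "snd g = snd h"
    using eq int gh by (simp add: vec_eq_iff)
  ultimately show "g = h"
    by (simp add: prod_eq_iff)
qed simp

lemma dihedral_group_lattice: "\<exists>l. (mat 1, l) \<in> dihedral_group \<and> norm (l + a) \<le> 20"
proof -
  \<comment> \<open>Multiples of 4 are admissible in every coordinate and leave remainders in [0,
    4), whence the bound 20 = 5 * 4.\<close>
  define n :: "int^5" where "n = (\<chi> i. - 4 * \<lfloor>a $ i / 4\<rfloor>)"
  let ?l = "(\<chi> i. of_int (n $ i)) :: real^5"
  have "admissible False False False n"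
    by (simp add: admissible_def n_def)
  then have "motion False False False n \<in> dihedral_group"
    by (rule motion_in_dihedral_group)
  then have "(mat 1, ?l) \<in> dihedral_group"
    by (simp add: motion_def matrix_hol_1)
  moreover have "\<bar>(?l + a) $ i\<bar> \<le> 4" for i
    unfolding n_def by simp linarith
  then have "(\<Sum>i\<in>UNIV. \<bar>(?l + a) $ i\<bar>) \<le> of_nat CARD(5) * 4"
    by (intro sum_bounded_above) auto
  then have "norm (?l + a) \<le> 20"
    using norm_le_l1_cart[of "?l + a"] by simp
  ultimately show ?thesis by blast
qed

lemma dihedral_group_no_fixed_direction:
  "\<exists>g\<in>dihedral_group. norm v \<le> norm (v - fst g *v v)"
proof -
  \<comment> \<open>These complete a half turn, an axis reflection and a quarter turn. Their squared
    displacements of \<open>v\<close> sum to at least three times the square of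
    \<open>norm v\<close>, so one displacement is at least \<open>norm v\<close>.\<close>
  define n1 n2 n3 :: "int^5" where
    "n1 = (\<chi> i. if i = 3 then 2 else 0)" and
    "n2 = (\<chi> i. if i = 3 \<or> i = 5 then 0 else 1)" and
    "n3 = (\<chi> i. if i = 3 \<or> i = 5 then 1 else 0)"
  have mem: "motion False True True n1 \<in> dihedral_group" "motion False False True n2 \<in> dihedral_group"
    "motion True False True n3 \<in> dihedral_group"
    by (auto intro!: motion_in_dihedral_group simp: admissible_def n1_def n2_def n3_def)
  have sq: "(norm w)\<^sup>2 = (w $ 1)\<^sup>2 + (w $ 2)\<^sup>2 + (w $ 3)\<^sup>2 + (w $ 4)\<^sup>2 + (w $ 5)\<^sup>2" for w :: "real^5"
    unfolding power2_norm_eq_inner by (simp add: inner_vec_def sum_5 power2_eq_square)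
  have "3 * (norm v)\<^sup>2 \<le> (norm (v - hol False True True v))\<^sup>2 + (norm (v - hol False False True v))\<^sup>2
      + (norm (v - hol True False True v))\<^sup>2"
  proof -
    have "(norm (v - hol False True True v))\<^sup>2 + (norm (v - hol False False True v))\<^sup>2
        + (norm (v - hol True False True v))\<^sup>2 =
        3 * (norm v)\<^sup>2 + (3 * (v $ 1)\<^sup>2 + 7 * (v $ 2)\<^sup>2 + (v $ 3)\<^sup>2 + (v $ 4)\<^sup>2 + 5 * (v $ 5)\<^sup>2)"
      unfolding sq by (simp add: power2_eq_square algebra_simps)
    then show ?thesis by simp
  qed
  then have "(norm v)\<^sup>2 \<le> (norm (v - hol False True True v))\<^sup>2 \<or>
      (norm v)\<^sup>2 \<le> (norm (v - hol False False True v))\<^sup>2 \<or> (norm v)\<^sup>2 \<le> (norm (v - hol True False True v))\<^sup>2"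
    by linarith
  then have "norm v \<le> norm (v - hol False True True v) \<or>
      norm v \<le> norm (v - hol False False True v) \<or> norm v \<le> norm (v - hol True False True v)"
    by (meson norm_ge_zero power2_le_imp_le)
  then show ?thesis
    using mem by (auto simp: motion_def intro: bexI[rotated])
qed

lemma dihedral_group_shift:
  assumes "(A, a) \<in> dihedral_group" "(A, a) \<noteq> (mat 1, 0)"
  shows "\<exists>j. (\<forall>v. (A *v v) $ j = v $ j) \<and> a $ j \<noteq> 0"
proof -
  obtain p c d n where g: "(A, a) = motion p c d n" and n: "admissible p c d n"
    using assms(1) by (rule dihedral_groupE)
  show ?thesis
  proof (cases "\<not> p \<and> \<not> c \<and> \<not> d")
    case True
    then have "A = mat 1"
      using g by (simp add: motion_def matrix_hol_1)
    moreover from this have "\<exists>j. a $ j \<noteq> 0"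
      using assms(2) by (auto simp: vec_eq_iff)
    ultimately show ?thesis by simp
  next
    case False
    consider "p = (c \<noteq> d)" | "\<not> p" "c \<noteq> d" | "p" "c = d"
      by blast
    then have "\<exists>j. (\<forall>v :: real^5. hol p c d v $ j = v $ j) \<and> n $ j \<noteq> 0"
    proof cases
      case 1
      then have "n $ 3 \<noteq> 0"
        using False n by (cases p; cases c) (auto simp: admissible_def)
      then show ?thesis
        using 1 by (intro exI[of _ 3]) simp
    next
      case 2
      then have "n $ 4 \<noteq> 0"
        using n by (auto simp: admissible_def)
      then show ?thesis
        using 2 by (intro exI[of _ 4]) simp
    next
      case 3
      then have "n $ 5 \<noteq> 0"
        using n by (auto simp: admissible_def)
      then show ?thesis
        using 3 by (intro exI[of _ 5]) simp
    qed
    then show ?thesis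
      using g by (simp add: motion_def)
  qed
qed

section \<open>Solutions of the relations of \<open>Delta_P\<close> in the group\<close>

lemma dihedral_group_rigid:
  assumes x: "x \<in> dihedral_group" and y: "y \<in> dihedral_group"
    and yx: "y \<otimes>\<^bsub>euclidean_group\<^esub> y \<otimes>\<^bsub>euclidean_group\<^esub> x \<otimes>\<^bsub>euclidean_group\<^esub> y \<otimes>\<^bsub>euclidean_group\<^esub> y = x"
    and xy: "x \<otimes>\<^bsub>euclidean_group\<^esub> x \<otimes>\<^bsub>euclidean_group\<^esub> y \<otimes>\<^bsub>euclidean_group\<^esub> x \<otimes>\<^bsub>euclidean_group\<^esub> x = y"
  shows "x = \<one>\<^bsub>euclidean_group\<^esub>"
proof -
  obtain p c d n where x_eq: "x = motion p c d n" and n: "admissible p c d n"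
    using x by (rule dihedral_groupE)
  obtain p' c' d' n' where y_eq: "y = motion p' c' d' n'" and n': "admissible p' c' d' n'"
    using y by (rule dihedral_groupE)
  \<comment> \<open>Each relation thus yields one integer equation per coordinate.\<close>
  have inj: "m = k" if "motion q a b m = motion q' a' b' k" for q a b m q' a' b' k
    using that by (auto simp: motion_def vec_eq_iff)
  note eq_yx = yx[unfolded x_eq y_eq motion_mult, THEN inj, THEN arg_cong, of "\<lambda>m. m $ i" for i]
  note eq_xy = xy[unfolded x_eq y_eq motion_mult, THEN inj, THEN arg_cong, of "\<lambda>m. m $ i" for i]
  have parity: "odd (n $ 1) \<longleftrightarrow> p \<noteq> (c \<noteq> d)" "odd (n $ 2) \<longleftrightarrow> p \<noteq> (c \<noteq> d)"
      "odd (n $ 4) \<longleftrightarrow> p \<noteq> (c \<noteq> d)" "odd (n $ 5) \<longleftrightarrow> p"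
      "4 dvd n $ 3 - (of_bool p + 2 * of_bool c)"
    "odd (n' $ 1) \<longleftrightarrow> p' \<noteq> (c' \<noteq> d')" "odd (n' $ 2) \<longleftrightarrow> p' \<noteq> (c' \<noteq> d')"
      "odd (n' $ 4) \<longleftrightarrow> p' \<noteq> (c' \<noteq> d')" "odd (n' $ 5) \<longleftrightarrow> p'"
      "4 dvd n' $ 3 - (of_bool p' + 2 * of_bool c')"
    using n n' by (simp_all add: admissible_def)
  have line3: "n $ 3 = 0" "n' $ 3 = 0" if "p = (c \<noteq> d)" "p' = (c' \<noteq> d')"
    using that eq_yx[of 3] eq_xy[of 3] by (cases p; cases p'; simp)+
  have line4: "n $ 4 = 0" "n' $ 4 = 0" if "\<not> p" "\<not> p'"
    using that eq_yx[of 4] eq_xy[of 4] by simp_all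
  have line5: "n $ 5 = 0" "n' $ 5 = 0" if "c = d" "c' = d'"
    using that eq_yx[of 5] eq_xy[of 5] by (cases p; cases p'; simp)+
  txt \<open>In the plane, \<open>p\<close> with \<open>c \<noteq> d\<close> is a quarter turn, \<open>p\<close> with \<open>c = d\<close> a diagonal reflection, and
    \<open>c \<noteq> d\<close> without \<open>p\<close> a glide along an axis.\<close>
  have p: "\<not> p \<and> \<not> p'"
  proof (rule ccontr)
    assume "\<not> (\<not> p \<and> \<not> p')"
    then consider "p" "p'" | "p" "\<not> p'" | "\<not> p" "p'" by blast
    then show False
    proof cases
      case 1
      then have "c = d \<longleftrightarrow> c' \<noteq> d'"
        using line3 line5 parity by auto
      \<comment> \<open>The square of the quarter turn is a half turn that must preserve the mirror,
        so its centre lies there. But the centre has integral coordinates with even sum, while on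
        the mirror their sum or difference is odd.\<close>
      then show False
        using 1 eq_yx[of 1] eq_yx[of 2] eq_xy[of 1] eq_xy[of 2] parity(1,2,6,7)
        by (cases c; cases c'; cases d; cases d'; simp; presburger)
    next
      case 2
      then have "c' \<noteq> d'"
        using line3 line5 parity by auto
      \<comment> \<open>In the plane, the square of \<open>y\<close> is a nonzero translation along
        an axis, which \<open>x\<close> carries to the perpendicular axis; the relation
        \<open>yx\<close> would make the two translations cancel.\<close>
      then show False
        using 2 eq_yx[of 1] eq_yx[of 2] parity(6,7)
        by (cases c; cases d; cases c'; simp; presburger)
    next
      case 3
      then have "c \<noteq> d"
        using line3 line5 parity by auto
      then show False
        using 3 eq_xy[of 1] eq_xy[of 2] parity(1,2)
        by (cases c'; cases d'; cases c; simp; presburger)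
    qed
  qed
  moreover from this have cd: "c = d" "c' = d'"
    using line4 parity(3,8) by auto
  moreover have "\<not> c" "\<not> c'"
    using p cd line3 parity(5,10) by (cases c; cases c'; simp)+
  ultimately have "\<not> p \<and> \<not> c \<and> \<not> d \<and> n $ 1 = 0 \<and> n $ 2 = 0 \<and> n $ 3 = 0 \<and> n $ 4 = 0 \<and> n $ 5 = 0"
    using line3 line4 line5 eq_yx[of 1] eq_yx[of 2] eq_xy[of 1] eq_xy[of 2] by simp
  then have "n = 0" "\<not> p" "\<not> c" "\<not> d"
    by (auto simp: vec_eq_iff forall_5)
  then show ?thesis
    by (simp add: x_eq motion_one)
qed

theorem proposition1:
  shows "\<exists>\<Gamma> :: ((real^5^5) \<times> (real^5)) set.
    bieberbach \<Gamma> \<and>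
    \<not> diffuse (euclidean_group\<lparr>carrier := \<Gamma>\<rparr>) \<and>
    \<not> (\<exists>H. subgroup H (euclidean_group\<lparr>carrier := \<Gamma>\<rparr>) \<and>
          (euclidean_group\<lparr>carrier := H\<rparr>) \<cong> Delta_P)"
proof (intro exI[of _ dihedral_group] conjI)
  note \<Gamma> = subgroup_dihedral_group
  have "crystallographic dihedral_group"
    using \<Gamma> uniform_discrete_imp_discrete[OF uniform_discrete_dihedral_group] dihedral_group_lattice
    by (rule crystallographicI)
  moreover have "torsion_free (euclidean_group\<lparr>carrier := dihedral_group\<rparr>)"
    using \<Gamma> dihedral_group_shift by (rule torsion_freeI)
  ultimately show "bieberbach dihedral_group"
    by (simp add: bieberbach_def)
  have "finite {g \<in> dihedral_group. norm (snd g) \<le> r}" for r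
  proof -
    have "{g \<in> dihedral_group. norm (snd g) \<le> r} \<subseteq> {A. orthogonal_matrix A} \<times> cball 0 r"
      using subgroup.subset[OF \<Gamma>] by (auto simp: carrier_euclidean_group)
    then have "bounded {g \<in> dihedral_group. norm (snd g) \<le> r}"
      by (rule bounded_subset[rotated])
        (intro bounded_Times compact_imp_bounded compact_orthogonal_matrices compact_cball)
    moreover have "uniform_discrete {g \<in> dihedral_group. norm (snd g) \<le> r}"
      using uniform_discrete_dihedral_group by (rule uniform_discrete_subset) auto
    ultimately show ?thesis
      using uniform_discrete_finite_iff by blast
  qed
  moreover have "\<exists>w. (mat 1, w) \<in> dihedral_group \<and> w \<noteq> 0"
  proof -
    \<comment> \<open>Since 30 exceeds 20, the zero vector is not close enough to qualify as
      \<open>w\<close>.\<close>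
    obtain w where "(mat 1, w) \<in> dihedral_group" "norm (w + (\<chi> i. 30)) \<le> 20"
      using dihedral_group_lattice by blast
    moreover have "30 \<le> norm ((\<chi> i. 30) :: real^5)"
      using component_le_norm_cart[of "(\<chi> i. 30) :: real^5" 1] by simp
    ultimately show ?thesis by fastforce
  qed
  ultimately show "\<not> diffuse (euclidean_group\<lparr>carrier := dihedral_group\<rparr>)"
    using not_diffuse_if_no_fixed_direction[OF \<Gamma> _ dihedral_group_lattice, where c = 1]
      dihedral_group_no_fixed_direction by auto
  have "group (euclidean_group\<lparr>carrier := dihedral_group\<rparr>)"
    using \<Gamma> group_euclidean_group by (rule subgroup.subgroup_is_group)
  from no_Delta_P_subgroup[OF this] dihedral_group_rigid
  show "\<not> (\<exists>H. subgroup H (euclidean_group\<lparr>carrier := dihedral_group\<rparr>) \<and>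
      (euclidean_group\<lparr>carrier := H\<rparr>) \<cong> Delta_P)"
    by simp
qed

end
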